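(* Let $T^r$ act effectively and linearly on $S^{2n-1}$, and let $X=S^{2n-1}/T^r$ with associated matroid $M_X$ on the ground set $E$. Then the preimage in $S^{2n-1}$ of the rational singular set $\mathcal{S}\subseteq X$ is the union of all $S^H$, $H$ a hyperplane of $M_X$. Moreover, let $\mathcal{A}$ be the collection of all subsets $X_H$ of $X$, $H$ a hyperplane of $M_X$, together with all their intersections, and let $P$ be the poset $\mathcal{A}$ ordered by reverse inclusion. Then $P$ is isomorphic to the poset of flats of $M_X$ other than $E$, ordered by reverse inclusion.
   Context: A linear action of $T^r=(S^1)^r=T_1\times\cdots\times T_r$ on $S^{2n-1}$ is one given by a continuous homomorphism $T^r\to O(2n)$. Up to conjugation in $O(2n)$, one has $S^{2n-1}=S_1*\cdots*S_n\subset\mathbb{C}^n$ ($S_j$ the unit circle of the $j$-th coordinate, $*$ the join) and there is an integer $r\times n$ matrix $Z=(z_{ij})$ such that $e^{\sqrt{-1}\theta}\in T_i$ acts on $S_j$ by multiplication by $e^{\sqrt{-1}z_{ij}\theta}$. $M_X$ is the matroid on the set $E=\{e_1,\dots,e_n\}$ of columns of $Z$, in which a set of columns is independent iff it is linearly independent over $\mathbb{Q}$; it has rank $r$. A hyperplane is a flat of rank $r-1$. The rational singular set $\mathcal{S}$ is the image in $X$ of the points of $S^{2n-1}$ whose isotropy subgroup is infinite. For $A\subseteq E$, $S^A\subseteq S^{2n-1}$ is the join of the circles $S_j$ with $e_j\in A$ (empty if $A=\emptyset$), and $X_A$ is the image of $S^A$ in $X$. Intersections are over nonempty families of hyperplanes;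 the empty set belongs to $\mathcal{A}$ if it arises as such an intersection. *)

theory Defs
  imports "HOL-Analysis.Analysis"
begin

(* R^{2n} is complex^'n with its real inner product, so orthogonal_transformation below means
   real orthogonal (O(2n), not U(n)), and S^{2n-1} is sphere 0 1. The group operation of T^r is
   the componentwise product of complex^'r. *)

definition torus :: "(complex^'r) set" where
  "torus = {t. \<forall>i. norm (t $ i) = 1}"

definition torus_factor :: "'r \<Rightarrow> real \<Rightarrow> complex^'r" where
  "torus_factor i \<theta> = (\<chi> k. if k = i then cis \<theta> else 1)"

(* The operator norm topology on bounded linear maps induces the usual topology of O(2n). *)

definition O2n :: "((complex^'n) \<Rightarrow>\<^sub>L (complex^'n)) set" where
  "O2n = {f. orthogonal_transformation (blinfun_apply f)}"

type_synonym ('r, 'n) torus_rep = "complex^'r \<Rightarrow> ((complex^'n) \<Rightarrow>\<^sub>L (complex^'n))"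

definition linear_torus_action :: "('r::finite, 'n::finite) torus_rep \<Rightarrow> bool" where
  "linear_torus_action \<rho> \<longleftrightarrow>
     \<rho> ` torus \<subseteq> O2n \<and>
     continuous_on torus \<rho> \<and>
     (\<forall>s\<in>torus. \<forall>t\<in>torus. \<rho> (s * t) = \<rho> s o\<^sub>L \<rho> t)"

definition effective_action :: "('r::finite, 'n::finite) torus_rep \<Rightarrow> bool" where
  "effective_action \<rho> \<longleftrightarrow> (\<forall>t\<in>torus. (\<forall>x\<in>sphere 0 1. \<rho> t x = x) \<longrightarrow> t = 1)"

(* g is the conjugating element of O(2n): g o \<rho> o g^{-1} is diagonal with weights Z. *)

definition weight_matrix ::
    "('r::finite, 'n::finite) torus_rep \<Rightarrow> ((complex^'n) \<Rightarrow>\<^sub>L (complex^'n)) \<Rightarrow> int^'n^'r \<Rightarrow> bool" where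
  "weight_matrix \<rho> g Z \<longleftrightarrow>
     g \<in> O2n \<and>
     (\<forall>i \<theta> x j. g (\<rho> (torus_factor i \<theta>) x) $ j = cis (of_int (Z $ i $ j) * \<theta>) * (g x $ j))"

definition orbit :: "('r::finite, 'n::finite) torus_rep \<Rightarrow> complex^'n \<Rightarrow> (complex^'n) set" where
  "orbit \<rho> x = (\<lambda>t. \<rho> t x) ` torus"

definition isotropy :: "('r::finite, 'n::finite) torus_rep \<Rightarrow> complex^'n \<Rightarrow> (complex^'r) set" where
  "isotropy \<rho> x = {t\<in>torus. \<rho> t x = x}"

(* Points of X = S^{2n-1}/T^r are orbits, and the quotient map is orbit \<rho>. *)

definition rational_singular_set :: "('r::finite, 'n::finite) torus_rep \<Rightarrow> (complex^'n) set set" where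
  "rational_singular_set \<rho> = orbit \<rho> ` {x\<in>sphere 0 1. infinite (isotropy \<rho> x)}"

definition coord_circle :: "((complex^'n) \<Rightarrow>\<^sub>L (complex^'n)) \<Rightarrow> 'n::finite \<Rightarrow> (complex^'n) set" where
  "coord_circle g j = {x. \<exists>u. norm u = 1 \<and> g x = axis j u}"

(* The join of subsets of pairwise orthogonal unit spheres, realised in the ambient unit sphere. *)

definition sphere_join :: "'i set \<Rightarrow> ('i \<Rightarrow> 'v::real_vector set) \<Rightarrow> 'v set" where
  "sphere_join A S =
     {(\<Sum>j\<in>A. c j *\<^sub>R u j) | c u. (\<forall>j\<in>A. 0 \<le> c j \<and> u j \<in> S j) \<and> (\<Sum>j\<in>A. (c j)\<^sup>2) = 1}"

definition sub_sphere :: "((complex^'n) \<Rightarrow>\<^sub>L (complex^'n)) \<Rightarrow> 'n::finite set \<Rightarrow> (complex^'n) set" where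
  "sub_sphere g A = sphere_join A (coord_circle g)"

definition X_sub ::
    "('r::finite, 'n::finite) torus_rep \<Rightarrow> ((complex^'n) \<Rightarrow>\<^sub>L (complex^'n)) \<Rightarrow> 'n set \<Rightarrow> (complex^'n) set set" where
  "X_sub \<rho> g A = orbit \<rho> ` sub_sphere g A"

(* The ground set consists of labelled columns, i.e. it is UNIV :: 'n set; two equal columns are
   distinct (parallel) elements, whence the injectivity condition. *)

definition indep_columns :: "int^'n::finite^'r::finite \<Rightarrow> 'n set \<Rightarrow> bool" where
  "indep_columns Z A \<longleftrightarrow>
     (let col = (\<lambda>j. column j (map_matrix of_int Z :: rat^'n^'r))
      in inj_on col A \<and> vec.independent (col ` A))"

definition matroid_rank :: "('e::finite set \<Rightarrow> bool) \<Rightarrow> 'e set \<Rightarrow> nat" where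
  "matroid_rank indep A = Max (card ` {B. B \<subseteq> A \<and> indep B})"

definition flat :: "('e::finite set \<Rightarrow> bool) \<Rightarrow> 'e set \<Rightarrow> bool" where
  "flat indep F \<longleftrightarrow> (\<forall>e. e \<notin> F \<longrightarrow> matroid_rank indep (insert e F) > matroid_rank indep F)"

definition flats :: "int^'n::finite^'r::finite \<Rightarrow> 'n set set" where
  "flats Z = {F. flat (indep_columns Z) F}"

definition hyperplanes :: "int^'n::finite^'r::finite \<Rightarrow> 'n set set" where
  "hyperplanes Z = {H \<in> flats Z. matroid_rank (indep_columns Z) H = CARD('r) - 1}"

definition hyperplane_arrangement ::
    "('r::finite, 'n::finite) torus_rep \<Rightarrow> ((complex^'n) \<Rightarrow>\<^sub>L (complex^'n)) \<Rightarrow> int^'n^'r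
      \<Rightarrow> (complex^'n) set set set" where
  "hyperplane_arrangement \<rho> g Z =
     {(\<Inter>H\<in>\<H>. X_sub \<rho> g H) | \<H>. \<H> \<noteq> {} \<and> \<H> \<subseteq> hyperplanes Z}"

definition poset_isomorphic :: "'a set \<Rightarrow> ('a \<Rightarrow> 'a \<Rightarrow> bool) \<Rightarrow> 'b set \<Rightarrow> ('b \<Rightarrow> 'b \<Rightarrow> bool) \<Rightarrow> bool" where
  "poset_isomorphic A leA B leB \<longleftrightarrow>
     (\<exists>f. bij_betw f A B \<and> (\<forall>x\<in>A. \<forall>y\<in>A. leA x y \<longleftrightarrow> leB (f x) (f y)))"

end

theory Submission
  imports Defs "HOL-Library.Real_Mod"
begin

text \<open>
  In the coordinates given by \<open>g\<close>, the torus element with angles \<open>\<theta>\<close> multiplies the \<open>j\<close>-th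
  coordinate by the phase \<open>\<Sum>i. Z i j * \<theta> i\<close>. Hence the isotropy group of a point depends only on
  its support, the set \<open>A\<close> of its nonzero coordinates, and is the subgroup of the torus on which
  the characters given by the columns in \<open>A\<close> are trivial. This subgroup is finite exactly when
  those columns span the rational vector space of dimension \<open>r\<close>
  (\<open>infinite_weight_kernel_iff\<close>): a rational covector vanishing on the columns yields a
  one-parameter subgroup, while spanning columns bound the order of every coordinate of an
  element. The same dichotomy, applied to all columns at once, turns effectiveness into the
  statement that the matroid has rank \<open>r\<close>.

  A set of columns fails to span exactly when it lies in a hyperplane, and the sphere \<open>S\<^sup>A\<close>
  consists of the unit vectors with support in \<open>A\<close>; this gives the description of the singular
  set. As supports are constant along orbits, \<open>A \<mapsto> X\<^sub>A\<close> reflects and preserves inclusion and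
  turns intersections of sets of columns into intersections of subsets of \<open>X\<close>. The poset
  isomorphism is therefore a statement about the matroid alone: the proper flats are the
  intersections of nonempty families of hyperplanes, because a flat can be separated by a
  hyperplane from every element outside it (\<open>hyperplane_separating\<close>).
\<close>

section \<open>Flats and hyperplanes of a vector configuration\<close>

definition rat_column :: "int^'n::finite^'r::finite \<Rightarrow> 'n \<Rightarrow> rat^'r" where
  "rat_column Z j = column j (map_matrix of_int Z)"

lemma rat_column_nth: "rat_column Z j $ i = of_int (Z $ i $ j)"
  by (simp add: rat_column_def column_def map_matrix_def)

lemma indep_columns_iff:
  "indep_columns Z A \<longleftrightarrow> inj_on (rat_column Z) A \<and> vec.independent (rat_column Z ` A)"
  by (simp add: indep_columns_def rat_column_def[abs_def] Let_def)

text \<open>Translating rank into dimension lets spans and the exchange property of linear algebra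
  take over from matroid theory.\<close>

lemma matroid_rank_eq_dim:
  fixes col :: "'e::finite \<Rightarrow> 'a::field^'r"
  shows "matroid_rank (\<lambda>B. inj_on col B \<and> vec.independent (col ` B)) A = vec.dim (col ` A)"
  unfolding matroid_rank_def
proof (rule Max_eqI)
  show "finite (card ` {B. B \<subseteq> A \<and> inj_on col B \<and> vec.independent (col ` B)})"
    by simp
next
  fix k assume "k \<in> card ` {B. B \<subseteq> A \<and> inj_on col B \<and> vec.independent (col ` B)}"
  then obtain B where B: "B \<subseteq> A" "inj_on col B" "vec.independent (col ` B)" "k = card B"
    by auto
  have "card (col ` B) \<le> vec.dim (col ` A)"
    using B by (intro vec.independent_card_le_dim) auto
  thus "k \<le> vec.dim (col ` A)"
    using B by (simp add: card_image)
next
  obtain C where C: "C \<subseteq> col ` A" "vec.independent C" "card C = vec.dim (col ` A)"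
    using vec.basis_exists[of "col ` A"] by metis
  obtain B where B: "B \<subseteq> A" "inj_on col B" "C = col ` B"
    using C(1) by (metis subset_image_inj)
  show "vec.dim (col ` A) \<in> card ` {B. B \<subseteq> A \<and> inj_on col B \<and> vec.independent (col ` B)}"
    by (rule image_eqI[of _ _ B]) (use B C in \<open>auto simp: card_image\<close>)
qed

lemma rank_columns: "matroid_rank (indep_columns Z) A = vec.dim (rat_column Z ` A)"
  using matroid_rank_eq_dim[of "rat_column Z" A] by (simp add: indep_columns_iff[abs_def])

lemma flats_iff: "F \<in> flats Z \<longleftrightarrow> (\<forall>e. e \<notin> F \<longrightarrow> rat_column Z e \<notin> vec.span (rat_column Z ` F))"
  by (auto simp: flats_def flat_def rank_columns vec.dim_insert)

lemma hyperplanes_iff: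
  fixes Z :: "int^'n::finite^'r::finite"
  shows "H \<in> hyperplanes Z \<longleftrightarrow> H \<in> flats Z \<and> vec.dim (rat_column Z ` H) = CARD('r) - 1"
  by (simp add: hyperplanes_def rank_columns)

lemma hyperplane_not_spanning:
  fixes Z :: "int^'n::finite^'r::finite"
  assumes "H \<in> hyperplanes Z"
  shows "vec.span (rat_column Z ` H) \<noteq> UNIV"
proof
  assume "vec.span (rat_column Z ` H) = UNIV"
  hence "vec.dim (rat_column Z ` H) = CARD('r)"
    by (metis vec.dim_span vec_dim_card)
  moreover have "CARD('r) \<noteq> CARD('r) - 1"
    using zero_less_card_finite[where 'a='r] by linarith
  ultimately show False
    using assms by (simp add: hyperplanes_iff)
qed

lemma flats_Inter: "\<H> \<subseteq> flats Z \<Longrightarrow> \<Inter>\<H> \<in> flats Z"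
proof -
  assume *: "\<H> \<subseteq> flats Z"
  have "rat_column Z e \<notin> vec.span (rat_column Z ` \<Inter>\<H>)" if "e \<notin> H" "H \<in> \<H>" for e H
  proof -
    have "vec.span (rat_column Z ` \<Inter>\<H>) \<subseteq> vec.span (rat_column Z ` H)"
      using that by (intro vec.span_mono) auto
    moreover have "rat_column Z e \<notin> vec.span (rat_column Z ` H)"
      using that * by (auto simp: flats_iff)
    ultimately show ?thesis by blast
  qed
  thus ?thesis by (auto simp: flats_iff)
qed

text \<open>A set maximal among those containing \<open>A\<close> without \<open>e\<close> in their closure is a hyperplane: by
  exchange, adjoining \<open>e\<close> to it already spans everything, so its rank is one short of full.\<close>

lemma hyperplane_separating:
  fixes Z :: "int^'n::finite^'r::finite"
  assumes spanning: "vec.span (range (rat_column Z)) = UNIV"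
    and e: "rat_column Z e \<notin> vec.span (rat_column Z ` A)"
  obtains H where "H \<in> hyperplanes Z" "A \<subseteq> H" "e \<notin> H"
proof -
  let ?c = "rat_column Z"
  define \<F> where "\<F> = {H. A \<subseteq> H \<and> ?c e \<notin> vec.span (?c ` H)}"
  have "A \<in> \<F>" "finite \<F>" using e by (auto simp: \<F>_def)
  then obtain H where H: "H \<in> \<F>" and max: "\<And>G. G \<in> \<F> \<Longrightarrow> H \<subseteq> G \<Longrightarrow> H = G"
    by (metis finite_has_maximal2)
  have AH: "A \<subseteq> H" and eH: "?c e \<notin> vec.span (?c ` H)"
    using H by (auto simp: \<F>_def)
  have in_span: "?c e \<in> vec.span (insert (?c f) (?c ` H))" if "f \<notin> H" for f
    using max[of "insert f H"] that AH by (auto simp: \<F>_def)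
  have flat: "H \<in> flats Z"
    unfolding flats_iff
  proof (intro allI impI notI)
    fix f assume "f \<notin> H" "?c f \<in> vec.span (?c ` H)"
    thus False
      using in_span[of f] eH by (simp add: vec.span_redundant)
  qed
  have "?c f \<in> vec.span (insert (?c e) (?c ` H))" for f
  proof (cases "f \<in> H")
    case True
    thus ?thesis by (simp add: vec.span_base)
  next
    case False
    show ?thesis by (rule vec.in_span_insert[OF in_span[OF False] eH])
  qed
  hence "range ?c \<subseteq> vec.span (insert (?c e) (?c ` H))" by auto
  hence "vec.span (range ?c) \<subseteq> vec.span (insert (?c e) (?c ` H))"
    by (rule vec.span_minimal) simp
  hence "vec.span (insert (?c e) (?c ` H)) = UNIV" using spanning by auto
  hence "vec.dim (insert (?c e) (?c ` H)) = CARD('r)"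
    by (metis vec.dim_span vec_dim_card)
  hence "vec.dim (?c ` H) = CARD('r) - 1"
    using eH by (simp add: vec.dim_insert)
  moreover have "e \<notin> H" using eH by (auto intro: vec.span_base)
  ultimately show thesis using that flat AH by (auto simp: hyperplanes_iff)
qed

lemma not_spanning_iff_subset_hyperplane:
  fixes Z :: "int^'n::finite^'r::finite"
  assumes spanning: "vec.span (range (rat_column Z)) = UNIV"
  shows "vec.span (rat_column Z ` A) \<noteq> UNIV \<longleftrightarrow> (\<exists>H\<in>hyperplanes Z. A \<subseteq> H)"
proof
  assume "vec.span (rat_column Z ` A) \<noteq> UNIV"
  hence "\<not> range (rat_column Z) \<subseteq> vec.span (rat_column Z ` A)"
    using vec.span_minimal[of "range (rat_column Z)" "vec.span (rat_column Z ` A)"] spanning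
    by auto
  thus "\<exists>H\<in>hyperplanes Z. A \<subseteq> H"
    using hyperplane_separating[OF spanning] by blast
next
  assume "\<exists>H\<in>hyperplanes Z. A \<subseteq> H"
  then obtain H where H: "H \<in> hyperplanes Z" "A \<subseteq> H" by auto
  hence "vec.span (rat_column Z ` A) \<subseteq> vec.span (rat_column Z ` H)"
    by (intro vec.span_mono) auto
  thus "vec.span (rat_column Z ` A) \<noteq> UNIV"
    using hyperplane_not_spanning[OF H(1)] by auto
qed

lemma proper_flats_eq_hyperplane_intersections:
  fixes Z :: "int^'n::finite^'r::finite"
  assumes spanning: "vec.span (range (rat_column Z)) = UNIV"
  shows "flats Z - {UNIV} = {\<Inter>\<H> | \<H>. \<H> \<noteq> {} \<and> \<H> \<subseteq> hyperplanes Z}"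
proof (intro equalityI subsetI)
  fix F assume F: "F \<in> flats Z - {UNIV}"
  define \<H> where "\<H> = {H \<in> hyperplanes Z. F \<subseteq> H}"
  have sep: "\<exists>H\<in>\<H>. e \<notin> H" if "e \<notin> F" for e
    using hyperplane_separating[OF spanning, of e F] F that by (auto simp: \<H>_def flats_iff)
  have "F = \<Inter>\<H>" using sep by (auto simp: \<H>_def)
  moreover have "\<H> \<noteq> {}" using sep F by blast
  ultimately show "F \<in> {\<Inter>\<H> | \<H>. \<H> \<noteq> {} \<and> \<H> \<subseteq> hyperplanes Z}"
    by (auto simp: \<H>_def)
next
  fix F assume "F \<in> {\<Inter>\<H> | \<H>. \<H> \<noteq> {} \<and> \<H> \<subseteq> hyperplanes Z}"
  then obtain \<H> where F: "F = \<Inter>\<H>" "\<H> \<noteq> {}" "\<H> \<subseteq> hyperplanes Z" by auto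
  then obtain H where H: "H \<in> hyperplanes Z" "F \<subseteq> H" by auto
  have "F \<in> flats Z" using F by (auto simp: hyperplanes_def intro!: flats_Inter)
  moreover have "F \<noteq> UNIV"
    using hyperplane_not_spanning[OF H(1)] H(2) spanning by (auto simp: top.extremum_unique)
  ultimately show "F \<in> flats Z - {UNIV}" by simp
qed

section \<open>Subtori cut out by integral weights\<close>

definition torus_exp :: "('r \<Rightarrow> real) \<Rightarrow> complex^'r::finite" where
  "torus_exp \<theta> = (\<chi> i. cis (\<theta> i))"

definition phase :: "int^'n::finite^'r::finite \<Rightarrow> ('r \<Rightarrow> real) \<Rightarrow> 'n \<Rightarrow> real" where
  "phase Z \<theta> j = (\<Sum>i\<in>UNIV. of_int (Z $ i $ j) * \<theta> i)"

text \<open>The intersection of the kernels of the characters of the torus whose exponents are the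
  columns in \<open>A\<close>.\<close>

definition weight_kernel :: "int^'n::finite^'r::finite \<Rightarrow> 'n set \<Rightarrow> (complex^'r) set" where
  "weight_kernel Z A = torus_exp ` {\<theta>. \<forall>j\<in>A. cis (phase Z \<theta> j) = 1}"

lemma torus_eq_range_exp: "torus = range torus_exp"
proof (intro equalityI subsetI)
  fix t :: "complex^'r" assume "t \<in> torus"
  hence "cis (Arg (t $ i)) = t $ i" for i
    using rcis_cmod_Arg[of "t $ i"] by (simp add: torus_def rcis_def)
  hence "t = torus_exp (\<lambda>i. Arg (t $ i))"
    by (simp add: torus_exp_def vec_eq_iff)
  thus "t \<in> range torus_exp" by auto
qed (auto simp: torus_def torus_exp_def)

text \<open>Extend by linearity the map that kills a basis of the span and fixes one vector outside it;
  any row of its matrix that does not annihilate that vector is the covector wanted. An inner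
  product argument is not available over a general field.\<close>

lemma exists_annihilating_covector:
  fixes S :: "('a::field^'r::finite) set"
  assumes "vec.span S \<noteq> UNIV"
  obtains m :: "'a^'r" where "m \<noteq> 0" "\<And>x. x \<in> S \<Longrightarrow> (\<Sum>i\<in>UNIV. m $ i * x $ i) = 0"
proof -
  obtain e where e: "e \<notin> vec.span S" using assms by auto
  obtain B where B: "B \<subseteq> S" "vec.independent B" "S \<subseteq> vec.span B"
    using vec.maximal_independent_subset[of S] by metis
  have "e \<notin> vec.span B" using e B(1) vec.span_mono by blast
  hence "vec.independent (insert e B)" using B(2) by (simp add: vec.independent_insertI)
  then obtain f :: "'a^'r \<Rightarrow> 'a^'r"
    where f: "Vector_Spaces.linear (*s) (*s) f" "\<forall>x\<in>insert e B. f x = (if x = e then e else 0)"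
    using vec.linear_independent_extend[of "insert e B" "\<lambda>x. if x = e then e else 0"] by blast
  have "e \<notin> B" using \<open>e \<notin> vec.span B\<close> vec.span_base by blast
  have "f b = 0" if "b \<in> B" for b
    using f(2) \<open>e \<notin> B\<close> that by auto
  hence "f x = 0" if "x \<in> S" for x
    using vec.linear_eq_0_on_span[OF f(1), of B x] B(3) that by blast
  hence *: "(matrix f *v x) = 0" if "x \<in> S" for x
    using that by (simp add: matrix_works[OF f(1)])
  have "e \<noteq> 0" using e vec.span_zero by metis
  hence "matrix f *v e \<noteq> 0" using f(2) by (simp add: matrix_works[OF f(1)])
  then obtain i where i: "(matrix f *v e) $ i \<noteq> 0" by (auto simp: vec_eq_iff)
  show thesis
  proof (rule that[of "matrix f $ i"])
    show "matrix f $ i \<noteq> 0" using i by (auto simp: matrix_vector_mult_def)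
    show "(\<Sum>k\<in>UNIV. matrix f $ i $ k * x $ k) = 0" if "x \<in> S" for x
      using arg_cong[OF *[OF that], of "\<lambda>v. v $ i"] by (simp add: matrix_vector_mult_def)
  qed
qed

text \<open>A covector annihilating the columns is the direction of a one-parameter subgroup on which all
  their characters are trivial.\<close>

lemma infinite_weight_kernel:
  fixes Z :: "int^'n::finite^'r::finite"
  assumes "vec.span (rat_column Z ` A) \<noteq> UNIV"
  shows "infinite (weight_kernel Z A)"
proof
  assume fin: "finite (weight_kernel Z A)"
  obtain m :: "rat^'r" where m: "m \<noteq> 0"
    and ann: "\<And>j. j \<in> A \<Longrightarrow> (\<Sum>i\<in>UNIV. m $ i * rat_column Z j $ i) = 0"
    using exists_annihilating_covector[OF assms] by (metis image_eqI)
  obtain k where k: "m $ k \<noteq> 0" using m by (auto simp: vec_eq_iff)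
  \<comment> \<open>Normalised so that the \<open>k\<close>-th angle is \<open>s\<close> itself; then the cosine, injective on \<open>[0, \<pi>]\<close>,
    tells the points of the curve apart.\<close>
  define \<theta> where "\<theta> s i = s / of_rat (m $ k) * of_rat (m $ i)" for s :: real and i
  have "phase Z (\<theta> s) j = 0" if "j \<in> A" for s j
  proof -
    have "phase Z (\<theta> s) j
        = s / of_rat (m $ k) * of_rat (\<Sum>i\<in>UNIV. m $ i * rat_column Z j $ i)"
      by (simp add: phase_def \<theta>_def rat_column_nth of_rat_sum of_rat_mult sum_distrib_left mult_ac)
    thus ?thesis by (simp add: ann[OF that])
  qed
  hence "(\<lambda>s. torus_exp (\<theta> s)) ` {0..pi} \<subseteq> weight_kernel Z A"
    by (auto simp: weight_kernel_def)
  hence "finite ((\<lambda>t. Re (t $ k)) ` (\<lambda>s. torus_exp (\<theta> s)) ` {0..pi})"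
    using fin finite_subset by blast
  also have "(\<lambda>t. Re (t $ k)) ` (\<lambda>s. torus_exp (\<theta> s)) ` {0..pi} = cos ` {0..pi}"
    using k by (simp add: image_image torus_exp_def \<theta>_def)
  finally have "finite {0..pi}"
    by (rule finite_imageD) (auto intro!: inj_onI cos_inj_pi)
  thus False using pi_gt_zero by (simp add: infinite_Icc)
qed

text \<open>Clearing denominators in a linear combination of columns. The essential point is that \<open>D\<close>
  does not depend on \<open>\<theta>\<close>: it is this uniformity that yields finiteness of the kernel.\<close>

lemma integral_multiple_on_span:
  fixes Z :: "int^'n::finite^'r::finite" and v :: "rat^'r"
  assumes "v \<in> vec.span (rat_column Z ` A)"
  obtains D :: nat where "D > 0"
    "\<And>\<theta>. (\<forall>j\<in>A. cis (phase Z \<theta> j) = 1) \<Longrightarrow>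
       cis (of_nat D * (\<Sum>i\<in>UNIV. of_rat (v $ i) * \<theta> i)) = 1"
proof -
  let ?P = "\<lambda>v. \<exists>D>0::nat. \<forall>\<theta>. (\<forall>j\<in>A. cis (phase Z \<theta> j) = 1) \<longrightarrow>
       cis (of_nat D * (\<Sum>i\<in>UNIV. of_rat (v $ i) * \<theta> i)) = 1"
  have "?P v"
    using assms
  proof (induction rule: vec.span_induct_alt)
    case base
    show ?case by (auto intro!: exI[of _ 1])
  next
    case (step c x y)
    obtain j where j: "j \<in> A" "x = rat_column Z j" using step by auto
    obtain D where D: "D > 0"
      and Dy: "\<And>\<theta>. (\<forall>j\<in>A. cis (phase Z \<theta> j) = 1) \<Longrightarrow>
        cis (of_nat D * (\<Sum>i\<in>UNIV. of_rat (y $ i) * \<theta> i)) = 1"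
      using step by auto
    obtain a b where ab: "c = of_int a / of_int b" "b > 0"
      by (cases c) (auto simp: Fract_of_int_quotient)
    have c: "real (nat b) * of_rat c = of_int a"
      using ab by (simp add: of_rat_divide)
    show ?case
    proof (intro exI[of _ "D * nat b"] conjI allI impI)
      show "D * nat b > 0" using D ab by simp
      fix \<theta> :: "'r \<Rightarrow> real" assume \<theta>: "\<forall>j\<in>A. cis (phase Z \<theta> j) = 1"
      define Y where "Y = (\<Sum>i\<in>UNIV. of_rat (y $ i) * \<theta> i)"
      have x: "(\<Sum>i\<in>UNIV. of_rat (x $ i) * \<theta> i) = phase Z \<theta> j"
        by (simp add: j phase_def rat_column_nth)
      have "(\<Sum>i\<in>UNIV. of_rat ((c *s x + y) $ i) * \<theta> i) = of_rat c * phase Z \<theta> j + Y"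
        by (simp add: x[symmetric] Y_def of_rat_add of_rat_mult sum.distrib sum_distrib_left
            algebra_simps)
      hence "of_nat (D * nat b) * (\<Sum>i\<in>UNIV. of_rat ((c *s x + y) $ i) * \<theta> i)
          = of_nat D * ((real (nat b) * of_rat c) * phase Z \<theta> j) + of_nat (nat b) * (of_nat D * Y)"
        by (simp add: algebra_simps)
      also have "\<dots> = of_int (int D * a) * phase Z \<theta> j + of_int b * (of_nat D * Y)"
        using ab unfolding c by simp
      finally have eq: "of_nat (D * nat b) * (\<Sum>i\<in>UNIV. of_rat ((c *s x + y) $ i) * \<theta> i)
          = of_int (int D * a) * phase Z \<theta> j + of_int b * (of_nat D * Y)" .
      have "cis (phase Z \<theta> j) = 1" "cis (of_nat D * Y) = 1"
        using \<theta> j Dy by (auto simp: Y_def)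
      then obtain p q :: int where
        "phase Z \<theta> j = of_int p * (2 * pi)" "of_nat D * Y = of_int q * (2 * pi)"
        unfolding cis_eq_1_iff by auto
      hence "of_nat (D * nat b) * (\<Sum>i\<in>UNIV. of_rat ((c *s x + y) $ i) * \<theta> i)
          = of_int (int D * a * p + b * q) * (2 * pi)"
        unfolding eq by (simp add: algebra_simps)
      thus "cis (of_nat (D * nat b) * (\<Sum>i\<in>UNIV. of_rat ((c *s x + y) $ i) * \<theta> i)) = 1"
        unfolding cis_eq_1_iff by blast
    qed
  qed
  thus thesis using that by blast
qed

lemma finite_vec_components:
  fixes R :: "'r::finite \<Rightarrow> 'a set"
  assumes "\<And>i. finite (R i)"
  shows "finite {t :: 'a^'r. \<forall>i. t $ i \<in> R i}"
proof -
  have "vec_nth ` {t :: 'a^'r. \<forall>i. t $ i \<in> R i} \<subseteq> (\<Pi>\<^sub>E i\<in>UNIV. R i)" by auto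
  moreover have "finite (\<Pi>\<^sub>E i\<in>UNIV. R i)" using assms by (intro finite_PiE) auto
  ultimately have "finite (vec_nth ` {t :: 'a^'r. \<forall>i. t $ i \<in> R i})"
    using finite_subset by blast
  thus ?thesis by (rule finite_imageD) (auto simp: inj_on_def vec_eq_iff)
qed

text \<open>When the unit vectors are rational combinations of the columns, every coordinate of an
  element of the kernel is a root of unity of bounded order.\<close>

lemma finite_weight_kernel:
  fixes Z :: "int^'n::finite^'r::finite"
  assumes "vec.span (rat_column Z ` A) = UNIV"
  shows "finite (weight_kernel Z A)"
proof -
  have "\<exists>D>0::nat. \<forall>t\<in>weight_kernel Z A. (t $ k) ^ D = 1" for k
  proof -
    obtain D :: nat where D: "D > 0"
      "\<And>\<theta>. (\<forall>j\<in>A. cis (phase Z \<theta> j) = 1) \<Longrightarrow>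
       cis (of_nat D * (\<Sum>i\<in>UNIV. of_rat (axis k 1 $ i) * \<theta> i)) = 1"
      using integral_multiple_on_span[of "axis k 1" Z A] assms by auto
    have "(\<Sum>i\<in>UNIV. of_rat (axis k 1 $ i) * \<theta> i) = \<theta> k" for \<theta> :: "'r \<Rightarrow> real"
    proof -
      have "(\<Sum>i\<in>UNIV. of_rat (axis k 1 $ i) * \<theta> i) = (\<Sum>i\<in>UNIV. if i = k then \<theta> i else 0)"
        by (rule sum.cong) (auto simp: axis_def)
      thus ?thesis by simp
    qed
    thus ?thesis
      using D by (auto simp: weight_kernel_def torus_exp_def Complex.DeMoivre intro!: exI[of _ D])
  qed
  then obtain D :: "'r \<Rightarrow> nat"
    where D: "\<And>k. D k > 0" "\<And>k t. t \<in> weight_kernel Z A \<Longrightarrow> (t $ k) ^ D k = 1"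
    by metis
  have "finite {t :: complex^'r. \<forall>k. t $ k \<in> {z. z ^ D k = 1}}"
    by (rule finite_vec_components) (use D(1) in \<open>simp add: finite_roots_unity Suc_leI\<close>)
  moreover have "weight_kernel Z A \<subseteq> {t. \<forall>k. t $ k \<in> {z. z ^ D k = 1}}" using D(2) by auto
  ultimately show ?thesis using finite_subset by blast
qed

lemma infinite_weight_kernel_iff:
  "infinite (weight_kernel Z A) \<longleftrightarrow> vec.span (rat_column Z ` A) \<noteq> UNIV"
  using infinite_weight_kernel finite_weight_kernel by blast

section \<open>Diagonalised torus actions\<close>

locale diagonalised_torus_action =
  fixes \<rho> :: "complex^'r::finite \<Rightarrow> ((complex^'n::finite) \<Rightarrow>\<^sub>L (complex^'n))"
    and g :: "(complex^'n) \<Rightarrow>\<^sub>L (complex^'n)"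
    and Z :: "int^'n^'r"
  assumes linear_action: "linear_torus_action \<rho>"
    and weights: "weight_matrix \<rho> g Z"
begin

definition supp :: "complex^'n \<Rightarrow> 'n set" where
  "supp x = {j. g x $ j \<noteq> 0}"

lemma orth: "orthogonal_transformation (blinfun_apply g)"
  using weights by (simp add: weight_matrix_def O2n_def)

lemma g_eq_iff: "g x = g y \<longleftrightarrow> x = y"
  using orthogonal_transformation_inj[OF orth] by (auto dest: injD)

lemma eq_by_coords: "(\<And>j. g x $ j = g y $ j) \<Longrightarrow> x = y"
  using g_eq_iff[of x y] by (simp add: vec_eq_iff[of "g x"])

lemma norm_g: "norm (g x) = norm x"
  using orth by (simp add: orthogonal_transformation_norm)

lemma \<rho>_mult: "s \<in> torus \<Longrightarrow> t \<in> torus \<Longrightarrow> \<rho> (s * t) x = \<rho> s (\<rho> t x)"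
  using linear_action by (simp add: linear_torus_action_def)

lemma norm_\<rho>: "t \<in> torus \<Longrightarrow> norm (\<rho> t x) = norm x"
  using linear_action
  by (auto simp: linear_torus_action_def O2n_def intro!: orthogonal_transformation_norm)

text \<open>Multiplicativity alone would only make the operator of the neutral element idempotent; the
  zero angle in the weight condition identifies it.\<close>

lemma \<rho>_one: "\<rho> 1 x = x"
proof -
  have "torus_factor undefined 0 = (1 :: complex^'r)"
    by (simp add: torus_factor_def vec_eq_iff)
  hence "g (\<rho> 1 x) $ j = g x $ j" for j
    using weights unfolding weight_matrix_def by (metis cis_zero mult_1 mult_zero_right)
  thus ?thesis by (rule eq_by_coords)
qed

text \<open>The weights prescribe the action of the circle factors only, so a general torus element is
  assembled one factor at a time.\<close>

lemma g_\<rho>_exp: "g (\<rho> (torus_exp \<theta>) x) $ j = cis (phase Z \<theta> j) * g x $ j"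
proof -
  have "g (\<rho> (torus_exp (\<lambda>i. if i \<in> I then \<theta> i else 0)) x) $ j
      = cis (\<Sum>i\<in>I. of_int (Z $ i $ j) * \<theta> i) * g x $ j" if "finite I" for I
    using that
  proof (induction I)
    case empty
    have "torus_exp (\<lambda>i. 0) = (1 :: complex^'r)" by (simp add: torus_exp_def vec_eq_iff)
    thus ?case by (simp add: \<rho>_one)
  next
    case (insert i I)
    let ?t = "torus_exp (\<lambda>i. if i \<in> I then \<theta> i else 0) :: complex^'r"
    have "torus_exp (\<lambda>k. if k \<in> insert i I then \<theta> k else 0) = torus_factor i (\<theta> i) * ?t"
      using insert.hyps by (auto simp: torus_exp_def torus_factor_def vec_eq_iff)
    moreover have "torus_factor i (\<theta> i) \<in> torus" "?t \<in> torus"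
      by (auto simp: torus_def torus_factor_def torus_exp_def)
    ultimately have "g (\<rho> (torus_exp (\<lambda>k. if k \<in> insert i I then \<theta> k else 0)) x) $ j
        = cis (of_int (Z $ i $ j) * \<theta> i) * g (\<rho> ?t x) $ j"
      using weights by (simp add: \<rho>_mult weight_matrix_def)
    thus ?case using insert by (simp add: cis_mult flip: mult.assoc)
  qed
  from this[of UNIV] show ?thesis by (simp add: phase_def)
qed

lemma isotropy_eq: "isotropy \<rho> x = weight_kernel Z (supp x)"
proof -
  have "\<rho> (torus_exp \<theta>) x = x \<longleftrightarrow> (\<forall>j\<in>supp x. cis (phase Z \<theta> j) = 1)" for \<theta>
    by (subst g_eq_iff[symmetric]) (auto simp: vec_eq_iff g_\<rho>_exp supp_def)
  thus ?thesis by (auto simp: isotropy_def weight_kernel_def torus_eq_range_exp)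
qed

lemma supp_\<rho>: "t \<in> torus \<Longrightarrow> supp (\<rho> t x) = supp x"
  by (auto simp: torus_eq_range_exp supp_def g_\<rho>_exp)

lemma orbit_self: "x \<in> orbit \<rho> x"
  unfolding orbit_def by (rule image_eqI[of _ _ 1]) (auto simp: \<rho>_one torus_def)

lemma orbit_eqD:
  assumes "orbit \<rho> x = orbit \<rho> y"
  shows "supp x = supp y" "norm x = norm y"
proof -
  obtain t where t: "t \<in> torus" "x = \<rho> t y"
    using orbit_self[of x] assms by (auto simp: orbit_def)
  show "supp x = supp y" "norm x = norm y"
    using t by (simp_all add: supp_\<rho> norm_\<rho>)
qed

lemma sub_sphere_eq: "sub_sphere g A = {x \<in> sphere 0 1. supp x \<subseteq> A}"
proof (intro equalityI subsetI)
  fix x assume "x \<in> sub_sphere g A"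
  then obtain c u where x: "x = (\<Sum>j\<in>A. c j *\<^sub>R u j)"
    and u: "\<forall>j\<in>A. u j \<in> coord_circle g j" and c: "(\<Sum>j\<in>A. (c j)\<^sup>2) = 1"
    by (auto simp: sub_sphere_def sphere_join_def)
  obtain v where v: "\<And>j. j \<in> A \<Longrightarrow> norm (v j) = 1 \<and> g (u j) = axis j (v j)"
    using u unfolding coord_circle_def by (simp, metis)
  have gx: "g x $ k = (if k \<in> A then c k *\<^sub>R v k else 0)" for k
  proof -
    have "g x $ k = (\<Sum>j\<in>A. c j *\<^sub>R axis j (v j) $ k)"
      using v by (simp add: x blinfun.sum_right blinfun.scaleR_right)
    also have "\<dots> = (\<Sum>j\<in>A. if j = k then c k *\<^sub>R v k else 0)"
      by (rule sum.cong) (auto simp: axis_def)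
    finally show ?thesis by simp
  qed
  have "(norm (g x))\<^sup>2 = (\<Sum>k\<in>UNIV. (norm (g x $ k))\<^sup>2)"
    by (simp add: norm_vec_def L2_set_def sum_nonneg)
  also have "\<dots> = (\<Sum>k\<in>A. (c k)\<^sup>2)"
    by (rule sum.mono_neutral_cong_right) (auto simp: gx v power_mult_distrib)
  finally have "(norm x)\<^sup>2 = 1\<^sup>2" using c by (simp add: norm_g)
  hence "norm x = 1" by (rule power2_eq_imp_eq) simp_all
  thus "x \<in> {x \<in> sphere 0 1. supp x \<subseteq> A}" using gx by (auto simp: supp_def)
next
  fix x assume "x \<in> {x \<in> sphere 0 1. supp x \<subseteq> A}"
  hence x: "norm x = 1" "\<And>j. j \<notin> A \<Longrightarrow> g x $ j = 0" by (auto simp: supp_def)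
  \<comment> \<open>Where the coordinate vanishes, the coefficient is 0 and any unit number serves.\<close>
  define w where "w j = (if g x $ j = 0 then 1 else sgn (g x $ j))" for j
  have w: "norm (w j) = 1" "norm (g x $ j) *\<^sub>R w j = g x $ j" for j
    by (auto simp: w_def norm_sgn sgn_div_norm)
  define u where "u j = inv (blinfun_apply g) (axis j (w j))" for j
  have u: "g (u j) = axis j (w j)" for j
    unfolding u_def by (rule surj_f_inv_f[OF orthogonal_transformation_surj[OF orth]])
  have "g (\<Sum>j\<in>A. norm (g x $ j) *\<^sub>R u j) $ k = g x $ k" for k
  proof -
    have "g (\<Sum>j\<in>A. norm (g x $ j) *\<^sub>R u j) $ k
        = (\<Sum>j\<in>A. norm (g x $ j) *\<^sub>R axis j (w j) $ k)"
      by (simp add: blinfun.sum_right blinfun.scaleR_right u)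
    also have "\<dots> = (\<Sum>j\<in>A. if j = k then g x $ k else 0)"
      by (rule sum.cong) (auto simp: axis_def w)
    finally show ?thesis using x by simp
  qed
  hence "x = (\<Sum>j\<in>A. norm (g x $ j) *\<^sub>R u j)" by (intro eq_by_coords) (rule sym)
  moreover have "(\<Sum>j\<in>A. (norm (g x $ j))\<^sup>2) = 1"
  proof -
    have "(\<Sum>j\<in>A. (norm (g x $ j))\<^sup>2) = (\<Sum>k\<in>UNIV. (norm (g x $ k))\<^sup>2)"
      by (rule sum.mono_neutral_left) (auto simp: x)
    also have "\<dots> = (norm (g x))\<^sup>2" by (simp add: norm_vec_def L2_set_def sum_nonneg)
    finally show ?thesis using x by (simp add: norm_g)
  qed
  moreover have "u j \<in> coord_circle g j" for j using u w by (auto simp: coord_circle_def)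
  ultimately show "x \<in> sub_sphere g A"
    unfolding sub_sphere_def sphere_join_def mem_Collect_eq
    by (intro exI[of _ "\<lambda>j. norm (g x $ j)"] exI[of _ u]) simp
qed

text \<open>Supports and norms are constant on orbits, so \<open>S\<^sup>A\<close> is the full preimage of \<open>X\<^sub>A\<close>. This is
  what makes passing to the quotient commute with intersections.\<close>

lemma orbit_in_X_sub_iff: "orbit \<rho> x \<in> X_sub \<rho> g A \<longleftrightarrow> x \<in> sub_sphere g A"
proof
  assume "orbit \<rho> x \<in> X_sub \<rho> g A"
  then obtain y where "orbit \<rho> x = orbit \<rho> y" "y \<in> sub_sphere g A"
    by (auto simp: X_sub_def)
  thus "x \<in> sub_sphere g A"
    by (simp add: sub_sphere_eq orbit_eqD[of x y])
qed (simp add: X_sub_def)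

lemma X_sub_subset_iff: "X_sub \<rho> g A \<subseteq> X_sub \<rho> g B \<longleftrightarrow> A \<subseteq> B"
proof
  assume *: "X_sub \<rho> g A \<subseteq> X_sub \<rho> g B"
  show "A \<subseteq> B"
  proof
    fix j assume j: "j \<in> A"
    obtain x where x: "g x = axis j 1"
      using orthogonal_transformation_surj[OF orth] by (metis surjD)
    have "norm x = 1" using norm_g[of x] x by (simp add: norm_axis_1)
    moreover have "supp x = {j}" using x by (auto simp: supp_def axis_def)
    ultimately show "j \<in> B"
      using * j orbit_in_X_sub_iff[of x] by (auto simp: sub_sphere_eq)
  qed
next
  assume "A \<subseteq> B"
  thus "X_sub \<rho> g A \<subseteq> X_sub \<rho> g B" by (auto simp: X_sub_def sub_sphere_eq)
qed

lemma X_sub_Inter: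
  assumes "\<H> \<noteq> {}"
  shows "(\<Inter>H\<in>\<H>. X_sub \<rho> g H) = X_sub \<rho> g (\<Inter>\<H>)"
proof (intro equalityI subsetI)
  fix y assume y: "y \<in> (\<Inter>H\<in>\<H>. X_sub \<rho> g H)"
  then obtain x where x: "y = orbit \<rho> x" using assms by (auto simp: X_sub_def)
  hence "x \<in> sub_sphere g H" if "H \<in> \<H>" for H
    using y that by (auto simp: orbit_in_X_sub_iff)
  hence "x \<in> sub_sphere g (\<Inter>\<H>)" using assms by (auto simp: sub_sphere_eq)
  thus "y \<in> X_sub \<rho> g (\<Inter>\<H>)" by (simp add: x orbit_in_X_sub_iff)
next
  fix y assume "y \<in> X_sub \<rho> g (\<Inter>\<H>)"
  thus "y \<in> (\<Inter>H\<in>\<H>. X_sub \<rho> g H)"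
    using X_sub_subset_iff[of "\<Inter>\<H>"] by (auto 4 4)
qed

lemma orbit_in_singular_set_iff:
  assumes "x \<in> sphere 0 1"
  shows "orbit \<rho> x \<in> rational_singular_set \<rho> \<longleftrightarrow> vec.span (rat_column Z ` supp x) \<noteq> UNIV"
proof -
  have "orbit \<rho> x \<in> rational_singular_set \<rho> \<longleftrightarrow> infinite (isotropy \<rho> x)"
  proof
    assume "orbit \<rho> x \<in> rational_singular_set \<rho>"
    then obtain y where "infinite (isotropy \<rho> y)" "orbit \<rho> x = orbit \<rho> y"
      by (auto simp: rational_singular_set_def)
    thus "infinite (isotropy \<rho> x)" by (simp add: isotropy_eq orbit_eqD(1)[of x y])
  qed (use assms in \<open>auto simp: rational_singular_set_def\<close>)
  thus ?thesis by (simp add: isotropy_eq infinite_weight_kernel_iff)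
qed

text \<open>An element in the kernel of all columns fixes every vector, so effectiveness forces this
  kernel to be trivial, in particular finite.\<close>

lemma effective_imp_spanning:
  assumes "effective_action \<rho>"
  shows "vec.span (range (rat_column Z)) = UNIV"
proof (rule ccontr)
  assume "vec.span (range (rat_column Z)) \<noteq> UNIV"
  hence inf: "infinite (weight_kernel Z UNIV)" by (rule infinite_weight_kernel)
  have "t = 1" if "t \<in> weight_kernel Z UNIV" for t
  proof -
    have t: "t \<in> isotropy \<rho> x" for x
      using that by (auto simp: isotropy_eq weight_kernel_def)
    hence "t \<in> torus" "\<forall>x\<in>sphere 0 1. \<rho> t x = x" by (auto simp: isotropy_def)
    thus ?thesis using assms by (simp add: effective_action_def)
  qed
  hence "weight_kernel Z UNIV \<subseteq> {1}" by auto
  thus False using inf finite_subset by blast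
qed

end

section \<open>The singular set and its poset of strata\<close>

theorem mainTheorem5:
  fixes \<rho> :: "complex^'r::finite \<Rightarrow> ((complex^'n::finite) \<Rightarrow>\<^sub>L (complex^'n))"
    and g :: "(complex^'n) \<Rightarrow>\<^sub>L (complex^'n)"
    and Z :: "int^'n^'r"
  assumes "linear_torus_action \<rho>"
    and "effective_action \<rho>"
    and "weight_matrix \<rho> g Z"
  shows "{x \<in> sphere 0 1. orbit \<rho> x \<in> rational_singular_set \<rho>} = (\<Union>H\<in>hyperplanes Z. sub_sphere g H)
    \<and> poset_isomorphic (hyperplane_arrangement \<rho> g Z) (\<lambda>x y. y \<subseteq> x) (flats Z - {UNIV}) (\<lambda>F G. G \<subseteq> F)"
proof -
  interpret diagonalised_torus_action \<rho> g Z
    by unfold_locales (use assms in auto)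
  note spanning = effective_imp_spanning[OF assms(2)]
  have "x \<in> sphere 0 1 \<and> orbit \<rho> x \<in> rational_singular_set \<rho>
      \<longleftrightarrow> (\<exists>H\<in>hyperplanes Z. x \<in> sub_sphere g H)" for x
  proof (cases "x \<in> sphere 0 1")
    case True
    thus ?thesis
      using orbit_in_singular_set_iff[OF True]
        not_spanning_iff_subset_hyperplane[OF spanning, of "supp x"]
      unfolding sub_sphere_eq by blast
  qed (auto simp: sub_sphere_eq)
  hence "{x \<in> sphere 0 1. orbit \<rho> x \<in> rational_singular_set \<rho>}
      = (\<Union>H\<in>hyperplanes Z. sub_sphere g H)"
    by blast
  moreover have "poset_isomorphic (hyperplane_arrangement \<rho> g Z) (\<lambda>x y. y \<subseteq> x)
      (flats Z - {UNIV}) (\<lambda>F G. G \<subseteq> F)"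
  proof -
    have inj: "inj (X_sub \<rho> g)"
    proof (rule injI)
      fix A B assume "X_sub \<rho> g A = X_sub \<rho> g B"
      hence "A \<subseteq> B" "B \<subseteq> A" by (simp_all flip: X_sub_subset_iff)
      thus "A = B" by (rule equalityI)
    qed
    have "hyperplane_arrangement \<rho> g Z
        = {X_sub \<rho> g (\<Inter>\<H>) | \<H>. \<H> \<noteq> {} \<and> \<H> \<subseteq> hyperplanes Z}"
      unfolding hyperplane_arrangement_def using X_sub_Inter by (intro Collect_cong) metis
    also have "\<dots> = X_sub \<rho> g ` {\<Inter>\<H> | \<H>. \<H> \<noteq> {} \<and> \<H> \<subseteq> hyperplanes Z}"
      by blast
    finally have arr: "hyperplane_arrangement \<rho> g Z = X_sub \<rho> g ` (flats Z - {UNIV})"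
      by (simp only: proper_flats_eq_hyperplane_intersections[OF spanning])
    have inv: "inv (X_sub \<rho> g) (X_sub \<rho> g A) = A" for A
      by (rule inv_f_f[OF inj])
    have "bij_betw (inv (X_sub \<rho> g)) (hyperplane_arrangement \<rho> g Z) (flats Z - {UNIV})"
      unfolding arr by (intro bij_betw_byWitness[where f' = "X_sub \<rho> g"]) (auto simp: inv)
    moreover have "\<forall>x\<in>hyperplane_arrangement \<rho> g Z. \<forall>y\<in>hyperplane_arrangement \<rho> g Z.
        y \<subseteq> x \<longleftrightarrow> inv (X_sub \<rho> g) y \<subseteq> inv (X_sub \<rho> g) x"
      unfolding arr ball_simps inv X_sub_subset_iff by blast
    ultimately show ?thesis
      unfolding poset_isomorphic_def by blast
  qed
  ultimately show ?thesis ..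
qed

end
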